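(* Every solid weakly positive implicative weak BCC-algebra is branchwise $\varphi$-implicative.
   Context: The operation is written by juxtaposition. A weak BCC-algebra is a set $G$ with a binary operation and a constant $0$ such that for all $x,y,z\in G$: $((xy)(zy))(xz)=0$; $xx=0$; $x0=x$; and $xy=yx=0$ implies $x=y$. Its natural partial order is $x\leqslant y\iff xy=0$. $I(G)$ denotes the set of minimal elements of $(G,\leqslant)$; for $a\in I(G)$ the branch initiated by $a$ is $B(a)=\{x\in G: a\leqslant x\}$. Elements $x,y$ are in the same branch if $x,y\in B(a)$ for some $a\in I(G)$. $G$ is solid if $(xy)z=(xz)y$ for all $x,y$ belonging to the same branch and all $z\in G$. $G$ is weakly positive implicative if $(xy)z=((xz)z)(yz)$ for all $x,y,z\in G$. $G$ is branchwise $\varphi$-implicative if $xy=(xy)\big(y(0(0y))\big)$ for all $x,y$ belonging to the same branch. *)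

theory Defs
  imports Main
begin

locale weak_BCC_algebra =
  fixes G :: "'a set"
    and mult :: "'a \<Rightarrow> 'a \<Rightarrow> 'a"  (infixl "\<cdot>" 70)
    and zero :: 'a  ("\<zero>")
  assumes closed: "\<lbrakk>x \<in> G; y \<in> G\<rbrakk> \<Longrightarrow> x \<cdot> y \<in> G"
    and zero_closed: "\<zero> \<in> G"
    and bcc: "\<lbrakk>x \<in> G; y \<in> G; z \<in> G\<rbrakk> \<Longrightarrow> ((x \<cdot> y) \<cdot> (z \<cdot> y)) \<cdot> (x \<cdot> z) = \<zero>"
    and self_zero: "x \<in> G \<Longrightarrow> x \<cdot> x = \<zero>"
    and right_zero: "x \<in> G \<Longrightarrow> x \<cdot> \<zero> = x"
    and antisym: "\<lbrakk>x \<in> G; y \<in> G; x \<cdot> y = \<zero>; y \<cdot> x = \<zero>\<rbrakk> \<Longrightarrow> x = y"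
begin

definition below :: "'a \<Rightarrow> 'a \<Rightarrow> bool"  (infix "\<preceq>" 50)
  where "x \<preceq> y \<longleftrightarrow> x \<cdot> y = \<zero>"

definition minimal_elements :: "'a set"
  where "minimal_elements = {a \<in> G. \<forall>x\<in>G. x \<preceq> a \<longrightarrow> x = a}"

definition branch :: "'a \<Rightarrow> 'a set"
  where "branch a = {x \<in> G. a \<preceq> x}"

definition same_branch :: "'a \<Rightarrow> 'a \<Rightarrow> bool"
  where "same_branch x y \<longleftrightarrow> (\<exists>a\<in>minimal_elements. x \<in> branch a \<and> y \<in> branch a)"

definition solid :: bool
  where "solid \<longleftrightarrow>
    (\<forall>x\<in>G. \<forall>y\<in>G. \<forall>z\<in>G. same_branch x y \<longrightarrow> (x \<cdot> y) \<cdot> z = (x \<cdot> z) \<cdot> y)"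

definition weakly_positive_implicative :: bool
  where "weakly_positive_implicative \<longleftrightarrow>
    (\<forall>x\<in>G. \<forall>y\<in>G. \<forall>z\<in>G. (x \<cdot> y) \<cdot> z = ((x \<cdot> z) \<cdot> z) \<cdot> (y \<cdot> z))"

definition branchwise_phi_implicative :: bool
  where "branchwise_phi_implicative \<longleftrightarrow>
    (\<forall>x\<in>G. \<forall>y\<in>G. same_branch x y \<longrightarrow> x \<cdot> y = (x \<cdot> y) \<cdot> (y \<cdot> (\<zero> \<cdot> (\<zero> \<cdot> y))))"

end

end

theory Submission
  imports Defs
begin

text \<open>
  Let \<open>x\<close> and \<open>y\<close> lie in the branch initiated by \<open>a\<close>. Then \<open>\<zero> \<cdot> (\<zero> \<cdot> y) = a\<close> and
  \<open>\<zero> \<cdot> a = \<zero> \<cdot> y\<close>, so the claim is \<open>x \<cdot> y = (x \<cdot> y) \<cdot> z\<close> for \<open>z = y \<cdot> a\<close>. Solidity gives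
  \<open>z \<cdot> y = (y \<cdot> y) \<cdot> a = \<zero> \<cdot> a = \<zero> \<cdot> y\<close>. Solidity and two instances of weak positive
  implicativity then yield
  \<open>(x \<cdot> y) \<cdot> z = (x \<cdot> z) \<cdot> y = ((x \<cdot> y) \<cdot> y) \<cdot> (z \<cdot> y) = ((x \<cdot> y) \<cdot> y) \<cdot> (\<zero> \<cdot> y) = (x \<cdot> \<zero>) \<cdot> y = x \<cdot> y\<close>.
\<close>

context weak_BCC_algebra
begin

lemma double_negation_below:
  assumes "y \<in> G"
  shows "\<zero> \<cdot> (\<zero> \<cdot> y) \<preceq> y"
  using bcc[OF assms assms zero_closed] assms
  by (simp add: below_def self_zero right_zero)

lemma double_negation_eq_branch_initial:
  assumes a: "a \<in> minimal_elements" and y: "y \<in> branch a"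
  shows "\<zero> \<cdot> (\<zero> \<cdot> y) = a"
proof -
  have aG: "a \<in> G" and yG: "y \<in> G" and ay: "a \<cdot> y = \<zero>"
    using a y by (auto simp: minimal_elements_def branch_def below_def)
  have "(\<zero> \<cdot> (\<zero> \<cdot> y)) \<preceq> a"
    using bcc[OF aG yG zero_closed] aG ay by (simp add: below_def right_zero)
  then show ?thesis
    using a yG by (simp add: minimal_elements_def closed zero_closed)
qed

lemma negation_constant_on_branch:
  assumes a: "a \<in> minimal_elements" and y: "y \<in> branch a"
  shows "\<zero> \<cdot> a = \<zero> \<cdot> y"
proof -
  have aG: "a \<in> G" and yG: "y \<in> G" and ay: "a \<cdot> y = \<zero>"
    using a y by (auto simp: minimal_elements_def branch_def below_def)
  have "(\<zero> \<cdot> y) \<cdot> (\<zero> \<cdot> a) = \<zero>"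
    using bcc[OF zero_closed yG aG] ay yG by (simp add: right_zero closed zero_closed)
  moreover have "(\<zero> \<cdot> a) \<cdot> (\<zero> \<cdot> y) = \<zero>"
    using double_negation_below[of "\<zero> \<cdot> y"] double_negation_eq_branch_initial[OF a y] yG
    by (simp add: below_def closed zero_closed)
  ultimately show ?thesis
    by (rule antisym[OF closed[OF zero_closed aG] closed[OF zero_closed yG], rotated])
qed

lemma solid_wpi_imp_phi_implicative:
  assumes solid: solid and wpi: weakly_positive_implicative
  shows branchwise_phi_implicative
  unfolding branchwise_phi_implicative_def
proof (intro ballI impI)
  fix x y
  assume xG: "x \<in> G" and yG: "y \<in> G" and xy: "same_branch x y"
  then obtain a where a: "a \<in> minimal_elements" and y: "y \<in> branch a"
    by (auto simp: same_branch_def)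
  have aG: "a \<in> G"
    using a by (simp add: minimal_elements_def)
  have ya: "same_branch y a"
    using a y aG by (auto simp: same_branch_def branch_def below_def self_zero)
  define z where "z = y \<cdot> a"
  have zG: "z \<in> G"
    using aG yG by (simp add: z_def closed)
  have "z \<cdot> y = (y \<cdot> y) \<cdot> a"
    using solid ya aG yG unfolding z_def solid_def by blast
  then have zy: "z \<cdot> y = \<zero> \<cdot> y"
    using negation_constant_on_branch[OF a y] yG by (simp add: self_zero)
  have "(x \<cdot> y) \<cdot> z = (x \<cdot> z) \<cdot> y"
    using solid xy xG yG zG unfolding solid_def by blast
  also have "\<dots> = ((x \<cdot> y) \<cdot> y) \<cdot> (z \<cdot> y)"
    using wpi xG yG zG unfolding weakly_positive_implicative_def by blast
  also have "\<dots> = ((x \<cdot> y) \<cdot> y) \<cdot> (\<zero> \<cdot> y)"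
    by (simp only: zy)
  also have "\<dots> = (x \<cdot> \<zero>) \<cdot> y"
    using wpi[unfolded weakly_positive_implicative_def, rule_format, OF xG zero_closed yG] by (rule sym)
  also have "\<dots> = x \<cdot> y"
    using xG by (simp add: right_zero)
  finally show "x \<cdot> y = (x \<cdot> y) \<cdot> (y \<cdot> (\<zero> \<cdot> (\<zero> \<cdot> y)))"
    by (simp add: z_def double_negation_eq_branch_initial[OF a y])
qed

end

theorem theorem6p5:
  fixes G :: "'a set" and mult :: "'a \<Rightarrow> 'a \<Rightarrow> 'a" and zero :: 'a
  assumes "weak_BCC_algebra G mult zero"
    and "weak_BCC_algebra.solid G mult zero"
    and "weak_BCC_algebra.weakly_positive_implicative G mult"
  shows "weak_BCC_algebra.branchwise_phi_implicative G mult zero"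
  using assms by (rule weak_BCC_algebra.solid_wpi_imp_phi_implicative)

end
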